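(* Let $\mathbb S_2$ be the equational theory over the signature $\{\neg,\wedge^\bullet,\vee^\bullet,\mathsf T,\mathsf F\}$ axiomatised by $\neg\mathsf T=\mathsf F$; $\ \neg\neg x=x$; $\ \neg(x\wedge^\bullet y)=\neg x\vee^\bullet\neg y$; $\ (x\wedge^\bullet y)\wedge^\bullet z=x\wedge^\bullet(y\wedge^\bullet z)$; $\ \mathsf T\wedge^\bullet x=x$; $\ x\vee^\bullet(\neg x\wedge^\bullet y)=x\vee^\bullet y$; $\ x\wedge^\bullet y=y\wedge^\bullet x$. Then $\mathbb S_2$ is strictly weaker than propositional logic with $\neg,\wedge^\bullet,\vee^\bullet$ (where these are read as classical negation, conjunction and disjunction): every equation derivable in $\mathbb S_2$ is valid in propositional logic, but the absorption law $x\wedge^\bullet(x\vee^\bullet y)=x$, its commutative variants, and their duals are not derivable in $\mathbb S_2$.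
   Context: Derivability is in equational logic. An equation is valid in propositional logic if it holds in the two-element Boolean algebra. The commutative variants of the absorption law are obtained from $x\wedge^\bullet(x\vee^\bullet y)=x$ by exchanging the arguments of occurrences of $\wedge^\bullet$ and/or $\vee^\bullet$; duals are obtained by exchanging $\wedge^\bullet$ with $\vee^\bullet$ (and $\mathsf T$ with $\mathsf F$). $\mathbb S_2$ is the two-valued variant (without the constant for "undefined") of Bochvar's three-valued strict logic. *)

theory Defs
  imports Main
begin

datatype tm =
    Var nat
  | Top (\<open>T\<^sup>\<bullet>\<close>)
  | Bot (\<open>F\<^sup>\<bullet>\<close>)
  | Neg tm (\<open>\<not>\<^sup>\<bullet> _\<close> [80] 80)
  | Conj tm tm (infix \<open>\<and>\<^sup>\<bullet>\<close> 70)
  | Disj tm tm (infix \<open>\<or>\<^sup>\<bullet>\<close> 70)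

type_synonym eqn = "tm \<times> tm"

abbreviation Eqn :: "tm \<Rightarrow> tm \<Rightarrow> eqn"  (infix \<open>\<doteq>\<close> 55) where
  "s \<doteq> t \<equiv> (s, t)"

primrec subst :: "(nat \<Rightarrow> tm) \<Rightarrow> tm \<Rightarrow> tm" where
  "subst \<sigma> (Var n) = \<sigma> n"
| "subst \<sigma> T\<^sup>\<bullet> = T\<^sup>\<bullet>"
| "subst \<sigma> F\<^sup>\<bullet> = F\<^sup>\<bullet>"
| "subst \<sigma> (\<not>\<^sup>\<bullet> s) = \<not>\<^sup>\<bullet> (subst \<sigma> s)"
| "subst \<sigma> (s \<and>\<^sup>\<bullet> t) = subst \<sigma> s \<and>\<^sup>\<bullet> subst \<sigma> t"
| "subst \<sigma> (s \<or>\<^sup>\<bullet> t) = subst \<sigma> s \<or>\<^sup>\<bullet> subst \<sigma> t"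

inductive_set eq_theory :: "eqn set \<Rightarrow> eqn set" for E :: "eqn set" where
  ax: "e \<in> E \<Longrightarrow> e \<in> eq_theory E"
| refl: "(t \<doteq> t) \<in> eq_theory E"
| sym: "(s \<doteq> t) \<in> eq_theory E \<Longrightarrow> (t \<doteq> s) \<in> eq_theory E"
| trans: "(s \<doteq> t) \<in> eq_theory E \<Longrightarrow> (t \<doteq> u) \<in> eq_theory E \<Longrightarrow> (s \<doteq> u) \<in> eq_theory E"
| inst: "(s \<doteq> t) \<in> eq_theory E \<Longrightarrow> (subst \<sigma> s \<doteq> subst \<sigma> t) \<in> eq_theory E"
| cong_Neg: "(s \<doteq> s') \<in> eq_theory E \<Longrightarrow> (\<not>\<^sup>\<bullet> s \<doteq> \<not>\<^sup>\<bullet> s') \<in> eq_theory E"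
| cong_Conj: "(s \<doteq> s') \<in> eq_theory E \<Longrightarrow> (t \<doteq> t') \<in> eq_theory E \<Longrightarrow>
    (s \<and>\<^sup>\<bullet> t \<doteq> s' \<and>\<^sup>\<bullet> t') \<in> eq_theory E"
| cong_Disj: "(s \<doteq> s') \<in> eq_theory E \<Longrightarrow> (t \<doteq> t') \<in> eq_theory E \<Longrightarrow>
    (s \<or>\<^sup>\<bullet> t \<doteq> s' \<or>\<^sup>\<bullet> t') \<in> eq_theory E"

definition S2_axioms :: "eqn set" where
  "S2_axioms = (let x = Var 0; y = Var 1; z = Var 2 in
    {\<not>\<^sup>\<bullet> T\<^sup>\<bullet> \<doteq> F\<^sup>\<bullet>,
     \<not>\<^sup>\<bullet> (\<not>\<^sup>\<bullet> x) \<doteq> x,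
     \<not>\<^sup>\<bullet> (x \<and>\<^sup>\<bullet> y) \<doteq> \<not>\<^sup>\<bullet> x \<or>\<^sup>\<bullet> \<not>\<^sup>\<bullet> y,
     (x \<and>\<^sup>\<bullet> y) \<and>\<^sup>\<bullet> z \<doteq> x \<and>\<^sup>\<bullet> (y \<and>\<^sup>\<bullet> z),
     T\<^sup>\<bullet> \<and>\<^sup>\<bullet> x \<doteq> x,
     x \<or>\<^sup>\<bullet> (\<not>\<^sup>\<bullet> x \<and>\<^sup>\<bullet> y) \<doteq> x \<or>\<^sup>\<bullet> y,
     x \<and>\<^sup>\<bullet> y \<doteq> y \<and>\<^sup>\<bullet> x})"

definition S2 :: "eqn set" where
  "S2 = eq_theory S2_axioms"

primrec eval :: "(nat \<Rightarrow> bool) \<Rightarrow> tm \<Rightarrow> bool" where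
  "eval \<rho> (Var n) = \<rho> n"
| "eval \<rho> T\<^sup>\<bullet> = True"
| "eval \<rho> F\<^sup>\<bullet> = False"
| "eval \<rho> (\<not>\<^sup>\<bullet> s) = (\<not> eval \<rho> s)"
| "eval \<rho> (s \<and>\<^sup>\<bullet> t) = (eval \<rho> s \<and> eval \<rho> t)"
| "eval \<rho> (s \<or>\<^sup>\<bullet> t) = (eval \<rho> s \<or> eval \<rho> t)"

definition prop_valid :: "eqn set" where
  "prop_valid = {(s, t). \<forall>\<rho>. eval \<rho> s = eval \<rho> t}"

(* Commuting the arguments of any subset of the occurrences of \<and>\<^sup>\<bullet> and \<or>\<^sup>\<bullet>
   (the term itself included). *)
primrec comm_variants :: "tm \<Rightarrow> tm set" where
  "comm_variants (Var n) = {Var n}"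
| "comm_variants T\<^sup>\<bullet> = {T\<^sup>\<bullet>}"
| "comm_variants F\<^sup>\<bullet> = {F\<^sup>\<bullet>}"
| "comm_variants (\<not>\<^sup>\<bullet> s) = {\<not>\<^sup>\<bullet> s' |s'. s' \<in> comm_variants s}"
| "comm_variants (s \<and>\<^sup>\<bullet> t) =
    (\<Union>s' \<in> comm_variants s. \<Union>t' \<in> comm_variants t. {s' \<and>\<^sup>\<bullet> t', t' \<and>\<^sup>\<bullet> s'})"
| "comm_variants (s \<or>\<^sup>\<bullet> t) =
    (\<Union>s' \<in> comm_variants s. \<Union>t' \<in> comm_variants t. {s' \<or>\<^sup>\<bullet> t', t' \<or>\<^sup>\<bullet> s'})"

primrec dual :: "tm \<Rightarrow> tm" where
  "dual (Var n) = Var n"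
| "dual T\<^sup>\<bullet> = F\<^sup>\<bullet>"
| "dual F\<^sup>\<bullet> = T\<^sup>\<bullet>"
| "dual (\<not>\<^sup>\<bullet> s) = \<not>\<^sup>\<bullet> (dual s)"
| "dual (s \<and>\<^sup>\<bullet> t) = dual s \<or>\<^sup>\<bullet> dual t"
| "dual (s \<or>\<^sup>\<bullet> t) = dual s \<and>\<^sup>\<bullet> dual t"

definition absorption_variants :: "tm \<Rightarrow> tm \<Rightarrow> eqn set" where
  "absorption_variants x y = comm_variants (x \<and>\<^sup>\<bullet> (x \<or>\<^sup>\<bullet> y)) \<times> comm_variants x"

definition absorption_laws :: "tm \<Rightarrow> tm \<Rightarrow> eqn set" where
  "absorption_laws x y =
    absorption_variants x y \<union> map_prod dual dual ` absorption_variants x y"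

(* The two variables of the law must be taken distinct when asking about derivability:
   x \<and>\<^sup>\<bullet> (x \<or>\<^sup>\<bullet> x) \<doteq> x is only idempotence. *)
lemma absorption_laws_Var:
  "absorption_laws (Var m) (Var n) = (let x = Var m; y = Var n in
    {x \<and>\<^sup>\<bullet> (x \<or>\<^sup>\<bullet> y) \<doteq> x, x \<and>\<^sup>\<bullet> (y \<or>\<^sup>\<bullet> x) \<doteq> x,
     (x \<or>\<^sup>\<bullet> y) \<and>\<^sup>\<bullet> x \<doteq> x, (y \<or>\<^sup>\<bullet> x) \<and>\<^sup>\<bullet> x \<doteq> x,
     x \<or>\<^sup>\<bullet> (x \<and>\<^sup>\<bullet> y) \<doteq> x, x \<or>\<^sup>\<bullet> (y \<and>\<^sup>\<bullet> x) \<doteq> x,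
     (x \<and>\<^sup>\<bullet> y) \<or>\<^sup>\<bullet> x \<doteq> x, (y \<and>\<^sup>\<bullet> x) \<or>\<^sup>\<bullet> x \<doteq> x})"
  by (auto simp: absorption_laws_def absorption_variants_def Let_def)

end

(* Bochvar's strict three-valued logic is a model of S2: the undefined value None infects every
   compound term in which it occurs. Its restriction to the defined values is the two-element
   Boolean algebra, whence classical soundness; absorption fails when x is defined and y is not. *)
theory Submission
  imports Defs
begin

fun strict_binop :: "('a \<Rightarrow> 'a \<Rightarrow> 'a) \<Rightarrow> 'a option \<Rightarrow> 'a option \<Rightarrow> 'a option" where
  "strict_binop f (Some a) (Some b) = Some (f a b)"
| "strict_binop f _ _ = None"

primrec strict_eval :: "(nat \<Rightarrow> bool option) \<Rightarrow> tm \<Rightarrow> bool option" where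
  "strict_eval \<rho> (Var n) = \<rho> n"
| "strict_eval \<rho> T\<^sup>\<bullet> = Some True"
| "strict_eval \<rho> F\<^sup>\<bullet> = Some False"
| "strict_eval \<rho> (\<not>\<^sup>\<bullet> s) = map_option Not (strict_eval \<rho> s)"
| "strict_eval \<rho> (s \<and>\<^sup>\<bullet> t) = strict_binop (\<and>) (strict_eval \<rho> s) (strict_eval \<rho> t)"
| "strict_eval \<rho> (s \<or>\<^sup>\<bullet> t) = strict_binop (\<or>) (strict_eval \<rho> s) (strict_eval \<rho> t)"

text \<open>Handles the rule \<open>inst\<close>: a substitution is absorbed into the
  valuation.\<close>

lemma strict_eval_subst:
  "strict_eval \<rho> (subst \<sigma> t) = strict_eval (\<lambda>n. strict_eval \<rho> (\<sigma> n)) t"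
  by (induction t) simp_all

lemma strict_eval_Some: "strict_eval (\<lambda>n. Some (\<rho> n)) t = Some (eval \<rho> t)"
  by (induction t) simp_all

text \<open>Both sides of each axiom contain the same variables, so an undefined value makes both
  sides \<open>None\<close>; on defined values the axioms are Boolean identities. Only the variables
  0, 1 and 2 occur, hence the case split.\<close>

lemma strict_eval_S2_axioms:
  assumes "(s \<doteq> t) \<in> S2_axioms"
  shows "strict_eval \<rho> s = strict_eval \<rho> t"
  using assms
  by (cases "\<rho> 0"; cases "\<rho> 1"; cases "\<rho> 2") (auto simp: S2_axioms_def Let_def)

lemma strict_eval_eq_theory:
  assumes "(s \<doteq> t) \<in> eq_theory E"
    and "\<And>s t \<rho>. (s \<doteq> t) \<in> E \<Longrightarrow> strict_eval \<rho> s = strict_eval \<rho> t"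
  shows "strict_eval \<rho> s = strict_eval \<rho> t"
  using assms(1)
\<comment> \<open>The valuation must be general: for \<open>inst\<close> the induction hypothesis is
  used at \<open>\<lambda>n. strict_eval \<rho> (\<sigma> n)\<close>.\<close>
proof (induction "s \<doteq> t" arbitrary: s t \<rho>)
  case ax
  then show ?case by (rule assms(2))
qed (auto simp: strict_eval_subst)

lemma strict_eval_S2: "(s \<doteq> t) \<in> S2 \<Longrightarrow> strict_eval \<rho> s = strict_eval \<rho> t"
  unfolding S2_def using strict_eval_eq_theory strict_eval_S2_axioms by blast

lemma S2_subset_prop_valid: "S2 \<subseteq> prop_valid"
proof
  fix e assume "e \<in> S2"
  then obtain s t where e: "e = (s \<doteq> t)" and st: "(s \<doteq> t) \<in> S2"
    by (cases e) auto
  have "eval \<rho> s = eval \<rho> t" for \<rho>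
    \<comment> \<open>Everywhere defined valuations recover the classical semantics.\<close>
    using strict_eval_S2[OF st, of "\<lambda>n. Some (\<rho> n)"] by (simp add: strict_eval_Some)
  then show "e \<in> prop_valid"
    by (simp add: prop_valid_def e)
qed

lemma absorption_not_in_S2:
  assumes "m \<noteq> n" and "e \<in> absorption_laws (Var m) (Var n)"
  shows "e \<notin> S2"
proof
  assume S2: "e \<in> S2"
  obtain s t where e: "e = (s \<doteq> t)" by (cases e)
  \<comment> \<open>Only \<open>Var m\<close> is defined. Since \<open>n\<close> differs from
    \<open>m\<close>, the left side of each of the eight laws contains an undefined variable and is
    \<open>None\<close>, while the right side \<open>Var m\<close> is
    \<open>Some True\<close>.\<close>
  show False
    using strict_eval_S2[OF S2[unfolded e], of "(\<lambda>_. None)(m := Some True)"] assms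
    by (auto simp: absorption_laws_Var Let_def e)
qed

theorem mainTheorem6:
  "S2 \<subset> prop_valid \<and>
   (\<forall>m n. m \<noteq> n \<longrightarrow> (\<forall>e \<in> absorption_laws (Var m) (Var n). e \<notin> S2))"
proof -
  \<comment> \<open>A single absorption law, classically valid but not derivable, witnesses
    strictness of the inclusion.\<close>
  let ?e = "Var 0 \<and>\<^sup>\<bullet> (Var 0 \<or>\<^sup>\<bullet> Var 1) \<doteq> Var 0"
  have "?e \<notin> S2"
    by (rule absorption_not_in_S2[of 0 1]) (simp_all add: absorption_laws_Var Let_def)
  moreover have "?e \<in> prop_valid"
    by (auto simp: prop_valid_def)
  ultimately show ?thesis
    using S2_subset_prop_valid absorption_not_in_S2 by blast
qed

end
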